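(* Let $L$ be a closed spin Lagrangian submanifold with vanishing Maslov class or grading in a symplectic manifold $(X,\omega)$ that is closed or convex at infinity. If $L$ is properly unobstructed, then $L$ is (weakly) unobstructed in the usual sense, i.e. there exists a (weak) bounding cochain for the minimal $A_\infty$ algebra associated to $L$.
   Context: **Novikov field.** $\Lambda=\mathbb C((T^{\mathbb R}))=\{\sum_{i\ge0}a_iT^{\lambda_i}: a_i\in\mathbb C,\ \lambda_i\in\mathbb R,\ \lambda_i\nearrow+\infty\}$, with valuation $\mathrm{val}$ = smallest exponent with nonzero coefficient; $\Lambda_0=\{\mathrm{val}\ge0\}$. **Labels and $A_\infty$ algebras.** Write $H^*(L)=H^*(L;\mathbb R)$, $H_1(L)=H_1(L;\mathbb Z)$; $E(\beta)=\int_\beta\omega$ and $\mu(\beta)\in2\mathbb Z$ (Maslov index) for $\beta\in H_2(X,L)$, and $\partial:H_2(X,L)\to H_1(L)$ the boundary map. Let $C=\Omega^*(L)$ (differential $d$) or $C=H^*(L)$ (differential $0$). An operator system on $C$ is a collection $\mathfrak t=(\mathfrak t_{k,\beta})$, $k\ge0$, $\beta\in H_2(X,L)$, of multilinear maps $\mathfrak t_{k,\beta}:C^{\otimes k}\to C$ which is gapped: $\mathfrak t_{0,0}=0$; $\mathfrak t_{k,\beta}=0$ for all $k$ if $E(\beta)<0$ or if $E(\beta)=0,\beta\ne0$; and for each $E_0$ only finitely many $\beta$ with $E(\beta)\le E_0$ have some $\mathfrak t_{k,\beta}\neq0$. Put $x^\#=(-1)^{\deg x-1}x$. An $A_\infty$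 algebra with labels is an operator system $\mathfrak m$ with $\deg\mathfrak m_{k,\beta}=2-\mu(\beta)-k$ and $\sum_{\lambda+\nu+\rho=k}\sum_{\beta'+\beta''=\beta}\mathfrak m_{\lambda+\rho+1,\beta'}(x_1^\#,\dots,x_\lambda^\#,\mathfrak m_{\nu,\beta''}(x_{\lambda+1},\dots,x_{\lambda+\nu}),x_{\lambda+\nu+1},\dots,x_k)=0$ for all $k,\beta$. All $A_\infty$ algebras considered are assumed to lie in the category $\mathscr{UD}$: $\mathfrak m_{1,0}$ is the differential of $C$; the constant function $\mathbf 1$ is a unit ($\mathfrak m_{1,0}(\mathbf 1)=0$, $\mathfrak m_{2,0}(\mathbf 1,x)=(-1)^{\deg x}\mathfrak m_{2,0}(x,\mathbf 1)=x$, all other $\mathfrak m_{k,\beta}(\dots,\mathbf 1,\dots)=0$); cyclical unitality: $\sum_{i=1}^{k+1}\mathfrak m_{k+1,\beta}(x_1^\#,\dots,x_{i-1}^\#,\mathbf e,x_i,\dots,x_k)=0$ for $\mathbf e\in C^0$, $(k,\beta)\ne(0,0)$; divisor axiom: $\sum_{i=1}^{k+1}\mathfrak m_{k+1,\beta}(x_1,\dots,x_{i-1},b,x_i,\dots,x_k)=\langle\partial\beta,b\rangle\,\mathfrak m_{k,\beta}(x_1,\dots,x_k)$ for closed $b\in C^1$, $(k,\beta)\neq(0,0)$; semipositivity: $\mathfrak m_{k,\beta}\ne0\Rightarrow\mu(\beta)\ge0$. (Semipositivity is what the hypothesis "vanishing Maslov class or grading" is used for.) **The $A_\infty$ algebra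 of a Lagrangian.** For an $\omega$-tame almost complex structure $J$, let $\mathcal M_{k+1,\beta}(J,L)$ be the moduli space of genus-zero $J$-holomorphic stable maps with one disk boundary on $L$, $k+1$ ordered boundary marked points, and class $\beta$, with evaluation maps $\mathrm{ev}_0,\dots,\mathrm{ev}_k$. A choice $\Xi$ of virtual fundamental chains (compatible systems of Kuranishi structures and CF-perturbations on all these spaces, in the sense of Fukaya–Oh–Ohta–Ono) yields an $A_\infty$ algebra $\check{\mathfrak m}=\check{\mathfrak m}^{\Xi}$ on $\Omega^*(L)$ in $\mathscr{UD}$, heuristically $\check{\mathfrak m}_{k,\beta}(h_1,\dots,h_k)=(\mathrm{ev}_0)_!(\mathrm{ev}_1^*h_1\wedge\dots\wedge\mathrm{ev}_k^*h_k)$ for $\beta\neq0$, with $\check{\mathfrak m}_{1,0}=d$, $\check{\mathfrak m}_{2,0}(h_1,h_2)=\pm h_1\wedge h_2$, $\check{\mathfrak m}_{k,0}=0$ for $k\ne1,2$. The existence of such $\Xi$ is taken as an axiom. **Minimal model.** A Riemannian metric $g$ on $L$ gives, via Hodge decomposition, $i:H^*(L)\cong\mathcal H_g\hookrightarrow\Omega^*(L)$ (harmonic forms), the harmonic projection $\pi:\Omega^*(L)\to H^*(L)$, and a Green operator $G$ of degree $-1$ with $i\pi-\mathrm{id}=dG+Gd$, $\pi i=\mathrm{id}$, $G^2=0$, $Gi=0$, $\pi G=0$. Homological perturbation defines $\mathfrak i_{1,0}=i$, $\mathfrak m_{1,0}=0$, $\mathfrak i_{0,0}=\mathfrak m_{0,0}=0$,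 and inductively $\mathfrak i_{k,\beta}=\sum_{(\ell,\beta_0)\ne(1,0)}G\circ\check{\mathfrak m}_{\ell,\beta_0}\circ(\mathfrak i_{k_1,\beta_1}\otimes\dots\otimes\mathfrak i_{k_\ell,\beta_\ell})$, $\mathfrak m_{k,\beta}=\sum_{(\ell,\beta_0)\ne(1,0)}\pi\circ\check{\mathfrak m}_{\ell,\beta_0}\circ(\mathfrak i_{k_1,\beta_1}\otimes\dots\otimes\mathfrak i_{k_\ell,\beta_\ell})$ (sums over $\sum k_j=k$, $\beta_0+\sum\beta_j=\beta$). Then $\mathfrak m=\mathfrak m^{g,\Xi}$ is an $A_\infty$ algebra on $H^*(L)$ in $\mathscr{UD}$, called the minimal $A_\infty$ algebra associated to $L$. **Proper unobstructedness.** Since $\mathfrak m_{0,\beta}\in H^{2-\mu(\beta)}(L)$ and $\mu(\beta)\ge0$, for a basis $\Theta_1,\dots,\Theta_\ell$ of $H^2(L)$ one can write $\sum_\beta T^{E(\beta)}Y^{\partial\beta}\mathfrak m_{0,\beta}=W\cdot\mathbf 1+\sum_{i=1}^\ell Q_i\Theta_i$ with $W,Q_i$ formal series $\sum_{j\ge0} c_jY^{\alpha_j}$, $c_j\in\Lambda$, $\alpha_j\in H_1(L)$. The Lagrangian $L$ is *properly unobstructed* if all $Q_i$ vanish identically for some $\mathfrak m=\mathfrak m^{g,\Xi}$; this is independent of the choices of $J,g,\Xi$ (and basis), so equivalently for any. **Usual unobstructedness.** A (weak) bounding cochain is $b\in H^{odd}(L)\hat\otimes\Lambda_0$ with $\sum_{k\ge0}\sum_\beta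 T^{E(\beta)}\mathfrak m_{k,\beta}(b,\dots,b)=w\cdot\mathbf 1$ for some $w\in\Lambda_0$. For $b\in H^1(L;\Lambda_0)$ the sum over $k$ is evaluated by the divisor axiom: $\sum_k\mathfrak m_{k,\beta}(b,\dots,b)=e^{\langle\partial\beta,b\rangle}\mathfrak m_{0,\beta}$. $L$ is (weakly) unobstructed if such a $b$ exists. *)

theory Defs
  imports
    "HOL-Analysis.Analysis"
    "HOL-Homology.Homology"
    "HOL-Library.Function_Algebras"
begin

text \<open>
  Manifolds are smooth submanifolds of a Euclidean space, which by Whitney's theorem is no
  restriction; everything below depends only on the intrinsic structure, the ambient space being
  used to express smoothness.
\<close>

instantiation "fun" :: (type, real_vector) real_vector
begin
definition scaleR_fun :: "real \<Rightarrow> ('a \<Rightarrow> 'b) \<Rightarrow> 'a \<Rightarrow> 'b"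
  where "scaleR_fun r f = (\<lambda>x. r *\<^sub>R f x)"
instance
  by standard (simp_all add: scaleR_fun_def fun_eq_iff scaleR_add_right scaleR_add_left)
end

section \<open>Smooth maps and submanifolds\<close>

text \<open>In finite dimension, \<open>f\<close> is \<open>C\<^sup>\<infinity>\<close> iff all iterated directional derivatives exist and are
  differentiable.\<close>

coinductive smooth_fun :: "'a::real_normed_vector set \<Rightarrow> ('a \<Rightarrow> 'b::real_normed_vector) \<Rightarrow> bool"
  where "\<lbrakk>open U; \<forall>x\<in>U. f differentiable (at x);
    \<forall>v. smooth_fun U (\<lambda>x. frechet_derivative f (at x) v)\<rbrakk> \<Longrightarrow> smooth_fun U f"

definition smooth_on :: "'a::real_normed_vector set \<Rightarrow> ('a \<Rightarrow> 'b::real_normed_vector) \<Rightarrow> bool"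
  where "smooth_on S f \<longleftrightarrow>
    (\<forall>x\<in>S. \<exists>U h. x \<in> U \<and> smooth_fun U h \<and> (\<forall>y\<in>S \<inter> U. f y = h y))"

definition submanifold :: "nat \<Rightarrow> 'a::euclidean_space set \<Rightarrow> bool"
  where "submanifold n M \<longleftrightarrow>
    (\<forall>x\<in>M. \<exists>U V \<phi> \<psi> T. x \<in> U \<and> smooth_fun U \<phi> \<and> smooth_fun V \<psi> \<and> homeomorphism U V \<phi> \<psi> \<and>
       subspace (T :: 'a set) \<and> dim T = n \<and> \<phi> ` (M \<inter> U) = T \<inter> V)"

definition tangent_space :: "'a::euclidean_space set \<Rightarrow> 'a \<Rightarrow> 'a set"
  where "tangent_space M x = {v. \<exists>c \<epsilon>. 0 < \<epsilon> \<and> smooth_fun {-\<epsilon><..<\<epsilon>} c \<and> c 0 = x \<and>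
    c ` {-\<epsilon><..<\<epsilon>} \<subseteq> M \<and> (c has_vector_derivative v) (at (0::real))}"

section \<open>Differential forms\<close>

definition multilinear_on ::
  "'a::real_vector set \<Rightarrow> nat \<Rightarrow> ('a list \<Rightarrow> 'b::real_vector) \<Rightarrow> bool"
  where "multilinear_on V k f \<longleftrightarrow>
    (\<forall>us\<in>lists V. \<forall>vs\<in>lists V. length us + length vs + 1 = k \<longrightarrow>
      (\<forall>x\<in>V. \<forall>y\<in>V. \<forall>a b. f (us @ (a *\<^sub>R x + b *\<^sub>R y) # vs)
         = a *\<^sub>R f (us @ x # vs) + b *\<^sub>R f (us @ y # vs)))"

definition alternating_on ::
  "'a::real_vector set \<Rightarrow> nat \<Rightarrow> ('a list \<Rightarrow> 'b::real_vector) \<Rightarrow> bool"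
  where "alternating_on V k f \<longleftrightarrow> multilinear_on V k f \<and>
    (\<forall>vs\<in>lists V. length vs = k \<longrightarrow> \<not> distinct vs \<longrightarrow> f vs = 0)"

text \<open>A form takes a point and a list of tangent vectors of arbitrary length; its component of
  degree \<open>p\<close> is the restriction to lists of length \<open>p\<close>.  Off the base manifold and on lists that are
  not tangent it is \<open>0\<close>, so that equality of forms is equality of functions.\<close>

type_synonym 'a form = "'a \<Rightarrow> 'a list \<Rightarrow> real"

definition extends_form ::
  "'a::euclidean_space set \<Rightarrow> nat \<Rightarrow> 'a set \<Rightarrow> 'a form \<Rightarrow> 'a form \<Rightarrow> bool"
  where "extends_form M p U A \<alpha> \<longleftrightarrow>
    open U \<and> (\<forall>x\<in>U. alternating_on UNIV p (A x)) \<and>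
    (\<forall>vs. length vs = p \<longrightarrow> smooth_fun U (\<lambda>x. A x vs)) \<and>
    (\<forall>y\<in>M \<inter> U. \<forall>vs\<in>lists (tangent_space M y). length vs = p \<longrightarrow> \<alpha> y vs = A y vs)"

definition forms :: "'a::euclidean_space set \<Rightarrow> int \<Rightarrow> 'a form set"
  where "forms M p = {\<alpha>.
    (\<forall>x vs. \<alpha> x vs \<noteq> 0 \<longrightarrow> x \<in> M \<and> vs \<in> lists (tangent_space M x) \<and> int (length vs) = p) \<and>
    (0 \<le> p \<longrightarrow> (\<forall>x\<in>M. \<exists>U A. x \<in> U \<and> extends_form M (nat p) U A \<alpha>))}"

definition all_forms :: "'a::euclidean_space set \<Rightarrow> 'a form set"
  where "all_forms M = span (\<Union>p. forms M p)"

text \<open>\<open>(d\<alpha>)(v\<^sub>0,\<dots>,v\<^sub>p) = \<Sum>\<^sub>i (-1)\<^sup>i \<partial>\<^bsub>v\<^sub>i\<^esub> A(v\<^sub>0,\<dots>,v\<^sub>i omitted,\<dots>,v\<^sub>p)\<close> for any local ambient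
  extension \<open>A\<close> of the degree-\<open>p\<close> component of \<open>\<alpha>\<close>, with the \<open>v\<^sub>i\<close> constant vectors.\<close>

definition ext_deriv :: "'a::euclidean_space set \<Rightarrow> 'a form \<Rightarrow> 'a form"
  where "ext_deriv M \<alpha> = (\<lambda>x vs.
    if x \<in> M \<and> vs \<in> lists (tangent_space M x) \<and> vs \<noteq> [] then
      (THE r. \<exists>U A. x \<in> U \<and> extends_form M (length vs - 1) U A \<alpha> \<and>
        r = (\<Sum>i<length vs. (-1) ^ i *
          frechet_derivative (\<lambda>y. A y (take i vs @ drop (Suc i) vs)) (at x) (vs ! i)))
    else 0)"

text \<open>Exterior product as a sum over shuffles: \<open>I\<close> is the set of slots given to the first factor.\<close>

definition wedge_alt :: "('a list \<Rightarrow> real) \<Rightarrow> ('a list \<Rightarrow> real) \<Rightarrow> 'a list \<Rightarrow> real"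
  where "wedge_alt a b vs = (\<Sum>I\<in>Pow {..<length vs}.
    (-1) ^ card {(i, j). i \<in> I \<and> j \<in> {..<length vs} - I \<and> j < i} *
    a (nths vs I) * b (nths vs (- I)))"

definition wedge :: "'a form \<Rightarrow> 'a form \<Rightarrow> 'a form"
  where "wedge \<alpha> \<beta> = (\<lambda>x. wedge_alt (\<alpha> x) (\<beta> x))"

definition fun_form :: "'a set \<Rightarrow> ('a \<Rightarrow> real) \<Rightarrow> 'a form"
  where "fun_form M f = (\<lambda>x vs. if x \<in> M \<and> vs = [] then f x else 0)"

abbreviation one_form :: "'a set \<Rightarrow> 'a form"
  where "one_form M \<equiv> fun_form M (\<lambda>_. 1)"

definition linear_into :: "'a::real_vector set \<Rightarrow> 'b::real_vector set \<Rightarrow> ('a \<Rightarrow> 'b) \<Rightarrow> bool"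
  where "linear_into V W f \<longleftrightarrow> f ` V \<subseteq> W \<and>
    (\<forall>x\<in>V. \<forall>y\<in>V. \<forall>a b. f (a *\<^sub>R x + b *\<^sub>R y) = a *\<^sub>R f x + b *\<^sub>R f y)"

definition closed_forms :: "'a::euclidean_space set \<Rightarrow> 'a form set"
  where "closed_forms M = {\<alpha> \<in> all_forms M. ext_deriv M \<alpha> = 0}"

text \<open>\<open>cls\<close> exhibits the finite-dimensional space \<open>'h\<close> as \<open>H\<^sup>*(M;\<real>) = ker d / im d\<close>; the component
  of degree \<open>p\<close> is the set of classes of closed \<open>p\<close>-forms.\<close>

definition is_de_Rham :: "'a::euclidean_space set \<Rightarrow> ('a form \<Rightarrow> 'h::real_vector) \<Rightarrow> bool"
  where "is_de_Rham M cls \<longleftrightarrow>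
    linear_into (closed_forms M) UNIV cls \<and> cls ` closed_forms M = UNIV \<and>
    (\<forall>\<alpha>\<in>closed_forms M. cls \<alpha> = 0 \<longleftrightarrow> \<alpha> \<in> ext_deriv M ` all_forms M)"

definition coh :: "'a::euclidean_space set \<Rightarrow> ('a form \<Rightarrow> 'h::real_vector) \<Rightarrow> int \<Rightarrow> 'h set"
  where "coh M cls p = cls ` (forms M p \<inter> closed_forms M)"

section \<open>Hodge theory\<close>

definition riemannian_metric :: "'a::euclidean_space set \<Rightarrow> ('a \<Rightarrow> 'a \<Rightarrow> 'a \<Rightarrow> real) \<Rightarrow> bool"
  where "riemannian_metric M g \<longleftrightarrow>
    (\<forall>x\<in>M. \<forall>u\<in>tangent_space M x. (\<forall>v\<in>tangent_space M x. g x u v = g x v u) \<and>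
       (u \<noteq> 0 \<longrightarrow> 0 < g x u u)) \<and>
    (\<forall>x\<in>M. \<exists>U A. open U \<and> x \<in> U \<and> (\<forall>y\<in>U. bilinear (A y)) \<and>
       (\<forall>u v. smooth_fun U (\<lambda>y. A y u v)) \<and>
       (\<forall>y\<in>M \<inter> U. \<forall>u\<in>tangent_space M y. \<forall>v\<in>tangent_space M y. g y u v = A y u v))"

definition orthonormal_frame ::
  "nat \<Rightarrow> 'a::euclidean_space set \<Rightarrow> ('a \<Rightarrow> 'a \<Rightarrow> 'a \<Rightarrow> real) \<Rightarrow> 'a \<Rightarrow> 'a list \<Rightarrow> bool"
  where "orthonormal_frame n M g x e \<longleftrightarrow> length e = n \<and> e \<in> lists (tangent_space M x) \<and>
    (\<forall>i<n. \<forall>j<n. g x (e ! i) (e ! j) = (if i = j then 1 else 0))"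

definition riemannian_volume ::
  "nat \<Rightarrow> 'a::euclidean_space set \<Rightarrow> ('a \<Rightarrow> 'a \<Rightarrow> 'a \<Rightarrow> real) \<Rightarrow> 'a form \<Rightarrow> bool"
  where "riemannian_volume n M g vol \<longleftrightarrow> vol \<in> forms M (int n) \<and>
    (\<forall>x\<in>M. \<forall>e. orthonormal_frame n M g x e \<longrightarrow> \<bar>vol x e\<bar> = 1)"

text \<open>\<open>(\<star>\<alpha>)(w) = \<Sum>\<^sub>I \<alpha>(e\<^sub>I) vol(e\<^sub>I, w)\<close>, so that \<open>\<alpha> \<and> \<star>\<beta> = \<langle>\<alpha>,\<beta>\<rangle> vol\<close>.\<close>

definition hodge_star ::
  "nat \<Rightarrow> 'a::euclidean_space set \<Rightarrow> ('a \<Rightarrow> 'a \<Rightarrow> 'a \<Rightarrow> real) \<Rightarrow> 'a form \<Rightarrow> 'a form \<Rightarrow> 'a form"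
  where "hodge_star n M g vol \<alpha> = (\<lambda>x ws.
    if x \<in> M \<and> ws \<in> lists (tangent_space M x) then
      (let e = (SOME e. orthonormal_frame n M g x e) in
        \<Sum>I | I \<subseteq> {..<n} \<and> card I + length ws = n. \<alpha> x (nths e I) * vol x (nths e I @ ws))
    else 0)"

text \<open>\<open>d\<^sup>* = (-1)\<^bsup>n(p+1)+1\<^esup> \<star> d \<star>\<close> on \<open>p\<close>-forms; the result has degree \<open>length ws = p - 1\<close>.\<close>

definition codiff ::
  "nat \<Rightarrow> 'a::euclidean_space set \<Rightarrow> ('a \<Rightarrow> 'a \<Rightarrow> 'a \<Rightarrow> real) \<Rightarrow> 'a form \<Rightarrow> 'a form \<Rightarrow> 'a form"
  where "codiff n M g vol \<alpha> = (\<lambda>x ws. (-1) ^ (n * length ws + 1) *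
    hodge_star n M g vol (ext_deriv M (hodge_star n M g vol \<alpha>)) x ws)"

definition harmonic_forms ::
  "nat \<Rightarrow> 'a::euclidean_space set \<Rightarrow> ('a \<Rightarrow> 'a \<Rightarrow> 'a \<Rightarrow> real) \<Rightarrow> 'a form \<Rightarrow> 'a form set"
  where "harmonic_forms n M g vol = {\<alpha> \<in> all_forms M.
    ext_deriv M (codiff n M g vol \<alpha>) + codiff n M g vol (ext_deriv M \<alpha>) = 0}"

text \<open>The image of the Hodge-theoretic \<open>G\<close> (\<open>-d\<^sup>*\<close> applied to the inverse Laplacian off the harmonic
  forms) consists of coexact forms, and together with the homotopy identity this determines \<open>\<pi>\<close> and
  \<open>G\<close> from the metric.  Nothing depends on the sign choice in \<open>vol\<close>.\<close>

definition hodge_data ::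
  "nat \<Rightarrow> 'a::euclidean_space set \<Rightarrow> ('a form \<Rightarrow> 'h::real_vector) \<Rightarrow> ('a \<Rightarrow> 'a \<Rightarrow> 'a \<Rightarrow> real) \<Rightarrow>
   ('h \<Rightarrow> 'a form) \<Rightarrow> ('a form \<Rightarrow> 'h) \<Rightarrow> ('a form \<Rightarrow> 'a form) \<Rightarrow> bool"
  where "hodge_data n M cls g i \<pi> G \<longleftrightarrow>
    (\<exists>vol. riemannian_volume n M g vol \<and>
       bij_betw i UNIV (harmonic_forms n M g vol) \<and>
       G ` all_forms M \<subseteq> codiff n M g vol ` all_forms M) \<and>
    linear_into UNIV (all_forms M) i \<and> (\<forall>h. i h \<in> closed_forms M \<and> cls (i h) = h) \<and>
    linear_into (all_forms M) UNIV \<pi> \<and>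
    linear_into (all_forms M) (all_forms M) G \<and>
    (\<forall>p. G ` forms M p \<subseteq> forms M (p - 1)) \<and>
    (\<forall>\<alpha>\<in>all_forms M. i (\<pi> \<alpha>) - \<alpha> = ext_deriv M (G \<alpha>) + G (ext_deriv M \<alpha>)) \<and>
    (\<forall>h. \<pi> (i h) = h) \<and> (\<forall>h. G (i h) = 0) \<and>
    (\<forall>\<alpha>\<in>all_forms M. G (G \<alpha>) = 0 \<and> \<pi> (G \<alpha>) = 0)"

section \<open>Symplectic manifolds and Lagrangian submanifolds\<close>

definition symplectic_manifold :: "nat \<Rightarrow> 'a::euclidean_space set \<Rightarrow> 'a form \<Rightarrow> bool"
  where "symplectic_manifold n X \<omega> \<longleftrightarrow> submanifold (2 * n) X \<and> \<omega> \<in> forms X 2 \<and>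
    ext_deriv X \<omega> = 0 \<and>
    (\<forall>x\<in>X. \<forall>u\<in>tangent_space X x. (\<forall>v\<in>tangent_space X x. \<omega> x [u, v] = 0) \<longrightarrow> u = 0)"

text \<open>Convexity at infinity in the sense of Eliashberg and Gromov: \<open>X\<close> is exhausted by compact domains
  whose smooth boundary has a neighbourhood carrying an outward pointing vector field \<open>Z\<close> with
  \<open>L\<^sub>Z \<omega> = d(\<iota>\<^sub>Z \<omega>) = \<omega>\<close>.\<close>

definition convex_at_infinity :: "'a::euclidean_space set \<Rightarrow> 'a form \<Rightarrow> bool"
  where "convex_at_infinity X \<omega> \<longleftrightarrow>
    (\<forall>K. compact K \<and> K \<subseteq> X \<longrightarrow> (\<exists>\<rho> c U Z.
       smooth_on X \<rho> \<and> compact {x \<in> X. \<rho> x \<le> c} \<and> K \<subseteq> {x \<in> X. \<rho> x < c} \<and>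
       open U \<and> {x \<in> X. \<rho> x = c} \<subseteq> U \<and>
       smooth_on (X \<inter> U) Z \<and> (\<forall>x\<in>X \<inter> U. Z x \<in> tangent_space X x) \<and>
       (\<forall>x\<in>X. \<rho> x = c \<longrightarrow> 0 < ext_deriv X (fun_form X \<rho>) x [Z x]) \<and>
       (\<forall>x\<in>X \<inter> U. \<forall>vs. ext_deriv (X \<inter> U)
          (\<lambda>y vs. if y \<in> X \<inter> U then \<omega> y (Z y # vs) else 0) x vs = \<omega> x vs)))"

definition lagrangian :: "nat \<Rightarrow> 'a::euclidean_space set \<Rightarrow> 'a form \<Rightarrow> 'a set \<Rightarrow> bool"
  where "lagrangian n X \<omega> L \<longleftrightarrow> submanifold n L \<and> L \<subseteq> X \<and>
    (\<forall>x\<in>L. \<forall>u\<in>tangent_space L x. \<forall>v\<in>tangent_space L x. \<omega> x [u, v] = 0)"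

definition tame_acs :: "'a::euclidean_space set \<Rightarrow> 'a form \<Rightarrow> ('a \<Rightarrow> 'a \<Rightarrow> 'a) \<Rightarrow> bool"
  where "tame_acs X \<omega> J \<longleftrightarrow>
    (\<forall>x\<in>X. \<forall>v\<in>tangent_space X x. J x v \<in> tangent_space X x \<and> J x (J x v) = - v \<and>
       (v \<noteq> 0 \<longrightarrow> 0 < \<omega> x [v, J x v])) \<and>
    (\<forall>x\<in>X. \<exists>U A. open U \<and> x \<in> U \<and> (\<forall>y\<in>U. linear (A y)) \<and> (\<forall>v. smooth_fun U (\<lambda>y. A y v)) \<and>
       (\<forall>y\<in>X \<inter> U. \<forall>v\<in>tangent_space X y. J y v = A y v))"

text \<open>A spin structure, following Milnor, is an orientation together with a class in
  \<open>H\<^sup>1(P;\<int>/2) = Hom(H\<^sub>1(P), \<int>/2)\<close> that is nonzero on every fibre of the bundle \<open>P\<close> of oriented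
  orthonormal frames.  The frames are those of \<open>TL \<oplus> \<real>\<^sup>2\<close>, so that the case \<open>dim L = 1\<close> needs no
  separate treatment; the metric is the one induced from the ambient space.\<close>

definition spin_frames ::
  "nat \<Rightarrow> 'a::euclidean_space set \<Rightarrow> 'a form \<Rightarrow> 'a set \<Rightarrow> ('a \<times> (nat \<Rightarrow> 'a \<times> real \<times> real)) set"
  where "spin_frames n L vol S = {(x, e). x \<in> L \<inter> S \<and>
    (\<forall>i. (i < n + 2 \<longrightarrow> fst (e i) \<in> tangent_space L x) \<and> (n + 2 \<le> i \<longrightarrow> e i = 0)) \<and>
    (\<forall>i<n + 2. \<forall>j<n + 2. e i \<bullet> e j = (if i = j then 1 else 0)) \<and>
    0 < wedge_alt (\<lambda>vs. vol x (map fst vs))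
          (wedge_alt (\<lambda>vs. if length vs = 1 then fst (snd (hd vs)) else 0)
                     (\<lambda>vs. if length vs = 1 then snd (snd (hd vs)) else 0))
          (map e [0..<n + 2])}"

definition spin :: "nat \<Rightarrow> 'a::euclidean_space set \<Rightarrow> bool"
  where "spin n L \<longleftrightarrow> (\<exists>vol \<phi>.
    vol \<in> forms L (int n) \<and> (\<forall>x\<in>L. \<exists>vs. vol x vs \<noteq> 0) \<and>
    \<phi> \<in> hom (homology_group 1 (top_of_set (spin_frames n L vol UNIV))) (integer_mod_group 2) \<and>
    (\<forall>x\<in>L. \<exists>c \<in> carrier (homology_group 1 (top_of_set (spin_frames n L vol {x}))).
       \<phi> (hom_induced 1 (top_of_set (spin_frames n L vol {x})) {}
            (top_of_set (spin_frames n L vol UNIV)) {} id c) \<noteq> 0))"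

section \<open>Labels: \<open>H\<^sub>2(X,L)\<close>, energy, Maslov index\<close>

abbreviation H2 :: "'a::euclidean_space set \<Rightarrow> 'a set \<Rightarrow> 'a chain set monoid"
  where "H2 X L \<equiv> relative_homology_group 2 (top_of_set X) L"

abbreviation H1 :: "'a::euclidean_space set \<Rightarrow> 'a set \<Rightarrow> 'a chain set monoid"
  where "H1 X L \<equiv> homology_group 1 (subtopology (top_of_set X) L)"

abbreviation bdry :: "'a::euclidean_space set \<Rightarrow> 'a set \<Rightarrow> 'a chain set \<Rightarrow> 'a chain set"
  where "bdry X L \<equiv> hom_boundary 2 (top_of_set X) L"

text \<open>Affine parametrisations of the standard 1- and 2-simplex.\<close>

definition seg :: "real \<Rightarrow> nat \<Rightarrow> real"
  where "seg t = (\<lambda>i. if i = 0 then 1 - t else if i = 1 then t else 0)"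

definition tri :: "real \<Rightarrow> real \<Rightarrow> nat \<Rightarrow> real"
  where "tri s t = (\<lambda>i. if i = 0 then 1 - s - t else if i = 1 then s else if i = 2 then t else 0)"

definition triangle :: "(real \<times> real) set"
  where "triangle = {(s, t). 0 \<le> s \<and> 0 \<le> t \<and> s + t \<le> 1}"

definition smooth_1chain :: "'a::euclidean_space chain \<Rightarrow> bool"
  where "smooth_1chain c \<longleftrightarrow> (\<forall>\<sigma>\<in>Poly_Mapping.keys c. smooth_on {0..1} (\<lambda>t. \<sigma> (seg t)))"

definition integral_1chain :: "'a::euclidean_space form \<Rightarrow> 'a chain \<Rightarrow> real"
  where "integral_1chain b c = (\<Sum>\<sigma>\<in>Poly_Mapping.keys c. of_int (Poly_Mapping.lookup c \<sigma>) *
    integral {0..1} (\<lambda>t. b (\<sigma> (seg t)) [vector_derivative (\<lambda>t. \<sigma> (seg t)) (at t within {0..1})]))"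

definition smooth_2chain :: "'a::euclidean_space chain \<Rightarrow> bool"
  where "smooth_2chain c \<longleftrightarrow>
    (\<forall>\<sigma>\<in>Poly_Mapping.keys c. smooth_on triangle (\<lambda>(s, t). \<sigma> (tri s t)))"

definition integral_2chain :: "'a::euclidean_space form \<Rightarrow> 'a chain \<Rightarrow> real"
  where "integral_2chain w c = (\<Sum>\<sigma>\<in>Poly_Mapping.keys c. of_int (Poly_Mapping.lookup c \<sigma>) *
    integral triangle (\<lambda>(s, t). w (\<sigma> (tri s t))
      [vector_derivative (\<lambda>s. \<sigma> (tri s t)) (at s), vector_derivative (\<lambda>t. \<sigma> (tri s t)) (at t)]))"

text \<open>\<open>\<langle>\<gamma>, b\<rangle>\<close> for \<open>\<gamma> \<in> H\<^sub>1(L)\<close> and a closed 1-form \<open>b\<close>: by Stokes, the integral over any smooth cycle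
  in the coset \<open>\<gamma>\<close>.\<close>

definition period :: "'a::euclidean_space chain set \<Rightarrow> 'a form \<Rightarrow> real"
  where "period \<gamma> b = (THE r. \<exists>c\<in>\<gamma>. smooth_1chain c \<and> r = integral_1chain b c)"

text \<open>Every class has a smooth representative, so this determines the homomorphism \<open>E\<close>.\<close>

definition is_energy :: "'a::euclidean_space set \<Rightarrow> 'a form \<Rightarrow> 'a set \<Rightarrow> ('a chain set \<Rightarrow> real) \<Rightarrow> bool"
  where "is_energy X \<omega> L E \<longleftrightarrow>
    (\<forall>\<beta>\<in>carrier (H2 X L). \<forall>\<beta>'\<in>carrier (H2 X L). E (\<beta> \<otimes>\<^bsub>H2 X L\<^esub> \<beta>') = E \<beta> + E \<beta>') \<and>
    (\<forall>\<beta>\<in>carrier (H2 X L). \<forall>c\<in>\<beta>. smooth_2chain c \<longrightarrow> E \<beta> = integral_2chain \<omega> c)"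

definition complex_volume ::
  "nat \<Rightarrow> 'a::euclidean_space set \<Rightarrow> ('a \<Rightarrow> 'a \<Rightarrow> 'a) \<Rightarrow> 'a \<Rightarrow> ('a list \<Rightarrow> complex) \<Rightarrow> bool"
  where "complex_volume n X J x \<eta> \<longleftrightarrow>
    alternating_on (tangent_space X x) n \<eta> \<and>
    (\<forall>us\<in>lists (tangent_space X x). \<forall>vs\<in>lists (tangent_space X x). \<forall>v\<in>tangent_space X x.
       length us + length vs + 1 = n \<longrightarrow> \<eta> (us @ J x v # vs) = \<i> * \<eta> (us @ v # vs)) \<and>
    (\<exists>vs\<in>lists (tangent_space X x). length vs = n \<and> \<eta> vs \<noteq> 0)"

text \<open>Continuity of a family \<open>\<eta>\<close> of functions of \<open>n\<close> tangent vectors along \<open>\<sigma> : S \<rightarrow> X\<close>, tested on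
  continuous vector fields along \<open>\<sigma>\<close>.\<close>

definition continuous_along ::
  "nat \<Rightarrow> 'a::euclidean_space set \<Rightarrow> 'p::topological_space set \<Rightarrow> ('p \<Rightarrow> 'a) \<Rightarrow>
   ('p \<Rightarrow> 'a list \<Rightarrow> complex) \<Rightarrow> bool"
  where "continuous_along n X S \<sigma> \<eta> \<longleftrightarrow>
    (\<forall>R fs. R \<subseteq> S \<and> length fs = n \<and>
       (\<forall>f\<in>set fs. continuous_on R f \<and> (\<forall>p\<in>R. f p \<in> tangent_space X (\<sigma> p))) \<longrightarrow>
       continuous_on R (\<lambda>p. \<eta> p (map (\<lambda>f. f p) fs)))"

text \<open>The Maslov index of a relative cycle \<open>c\<close>.  Choose along every singular 1-simplex \<open>\<tau>\<close> of \<open>X\<close> a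
  framed path \<open>\<Phi> \<tau>\<close> of Lagrangian subspaces whose end subspaces \<open>F\<close> depend only on the end points,
  and which is \<open>TL\<close> if \<open>\<tau>\<close> lies in \<open>L\<close>.  A 2-simplex \<open>\<sigma>\<close> then carries a loop of Lagrangian subspaces
  over its boundary, whose Maslov index \<open>w \<sigma>\<close> is the winding number of \<open>\<eta>(\<Phi>)\<^sup>2\<close>, where \<open>\<eta>\<close> trivialises
  the complex determinant of \<open>\<sigma>\<^sup>*TX\<close>.  In \<open>\<Sum> c(\<sigma>) w(\<sigma>)\<close> the choices over 1-simplices outside
  \<open>L\<close> cancel since \<open>\<partial>c\<close> is a chain in \<open>L\<close>.\<close>

definition lagrangian_edges ::
  "nat \<Rightarrow> 'a::euclidean_space set \<Rightarrow> 'a form \<Rightarrow> 'a set \<Rightarrow>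
   (((nat \<Rightarrow> real) \<Rightarrow> 'a) \<Rightarrow> real \<Rightarrow> 'a list) \<Rightarrow> bool"
  where "lagrangian_edges n X \<omega> L \<Phi> \<longleftrightarrow>
    (\<exists>F. \<forall>\<tau>. singular_simplex 1 (top_of_set X) \<tau> \<longrightarrow>
       (\<forall>t\<in>{0..1}. length (\<Phi> \<tau> t) = n \<and> distinct (\<Phi> \<tau> t) \<and> independent (set (\<Phi> \<tau> t)) \<and>
          \<Phi> \<tau> t \<in> lists (tangent_space X (\<tau> (seg t))) \<and>
          (\<forall>u\<in>set (\<Phi> \<tau> t). \<forall>v\<in>set (\<Phi> \<tau> t). \<omega> (\<tau> (seg t)) [u, v] = 0)) \<and>
       (\<forall>i<n. continuous_on {0..1} (\<lambda>t. \<Phi> \<tau> t ! i)) \<and>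
       span (set (\<Phi> \<tau> 0)) = F (\<tau> (seg 0)) \<and> span (set (\<Phi> \<tau> 1)) = F (\<tau> (seg 1)) \<and>
       (\<tau> ` standard_simplex 1 \<subseteq> L \<longrightarrow>
          (\<forall>t\<in>{0..1}. span (set (\<Phi> \<tau> t)) = tangent_space L (\<tau> (seg t)))))"

definition boundary_winding ::
  "nat \<Rightarrow> 'a::euclidean_space set \<Rightarrow> ('a \<Rightarrow> 'a \<Rightarrow> 'a) \<Rightarrow>
   (((nat \<Rightarrow> real) \<Rightarrow> 'a) \<Rightarrow> real \<Rightarrow> 'a list) \<Rightarrow> ((nat \<Rightarrow> real) \<Rightarrow> 'a) \<Rightarrow> real \<Rightarrow> bool"
  where "boundary_winding n X J \<Phi> \<sigma> r \<longleftrightarrow> (\<exists>\<eta> \<theta>.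
    (\<forall>p\<in>standard_simplex 2. complex_volume n X J (\<sigma> p) (\<eta> p)) \<and>
    continuous_along n X (standard_simplex 2) \<sigma> \<eta> \<and>
    (\<forall>k\<le>2. continuous_on {0..1} (\<theta> k) \<and>
       (\<forall>t\<in>{0..1}. \<exists>s>0. (\<eta> (simplical_face k (seg t)) (\<Phi> (singular_face 2 k \<sigma>) t))\<^sup>2
          = of_real s * cis (\<theta> k t))) \<and>
    r = (\<Sum>k\<le>2. (-1) ^ k * (\<theta> k 1 - \<theta> k 0)) / (2 * pi))"

definition is_maslov ::
  "nat \<Rightarrow> 'a::euclidean_space set \<Rightarrow> 'a form \<Rightarrow> 'a set \<Rightarrow> ('a chain set \<Rightarrow> int) \<Rightarrow> bool"
  where "is_maslov n X \<omega> L \<mu> \<longleftrightarrow>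
    (\<forall>\<beta>\<in>carrier (H2 X L). \<forall>\<beta>'\<in>carrier (H2 X L). \<mu> (\<beta> \<otimes>\<^bsub>H2 X L\<^esub> \<beta>') = \<mu> \<beta> + \<mu> \<beta>') \<and>
    (\<forall>\<beta>\<in>carrier (H2 X L). \<forall>c\<in>\<beta>. \<forall>J \<Phi> w. tame_acs X \<omega> J \<and> lagrangian_edges n X \<omega> L \<Phi> \<and>
       (\<forall>\<sigma>\<in>Poly_Mapping.keys c. boundary_winding n X J \<Phi> \<sigma> (w \<sigma>)) \<longrightarrow>
       of_int (\<mu> \<beta>) = (\<Sum>\<sigma>\<in>Poly_Mapping.keys c. of_int (Poly_Mapping.lookup c \<sigma>) * w \<sigma>))"

text \<open>A grading: a nowhere vanishing continuous section \<open>q\<close> of the square of the complex determinant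
  line bundle of \<open>T\<^sup>*X\<close>, with a continuous real lift of its phase on \<open>L\<close>.\<close>

definition graded_lagrangian :: "nat \<Rightarrow> 'a::euclidean_space set \<Rightarrow> 'a form \<Rightarrow> 'a set \<Rightarrow> bool"
  where "graded_lagrangian n X \<omega> L \<longleftrightarrow> (\<exists>J q \<theta>. tame_acs X \<omega> J \<and>
    (\<forall>x\<in>X. \<exists>\<eta>. complex_volume n X J x \<eta> \<and> (\<forall>vs\<in>lists (tangent_space X x). q x vs = (\<eta> vs)\<^sup>2)) \<and>
    continuous_along n X X id q \<and> continuous_on L \<theta> \<and>
    (\<forall>x\<in>L. \<forall>vs\<in>lists (tangent_space L x). length vs = n \<and> distinct vs \<and> independent (set vs) \<longrightarrow>
       (\<exists>s>0. q x vs = of_real s * cis (\<theta> x))))"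

section \<open>\<open>A\<^sub>\<infinity>\<close> algebras with labels\<close>

type_synonym ('b, 'c, 'd) operators = "nat \<Rightarrow> 'b \<Rightarrow> 'c list \<Rightarrow> 'd"

definition vanishes :: "'c set \<Rightarrow> ('b, 'c, 'd::zero) operators \<Rightarrow> nat \<Rightarrow> 'b \<Rightarrow> bool"
  where "vanishes V t k \<beta> \<longleftrightarrow> (\<forall>xs\<in>lists V. length xs = k \<longrightarrow> t k \<beta> xs = 0)"

definition operator_system ::
  "('b, 'z) monoid_scheme \<Rightarrow> ('b \<Rightarrow> real) \<Rightarrow> 'c::real_vector set \<Rightarrow> 'd::real_vector set \<Rightarrow>
   ('b, 'c, 'd) operators \<Rightarrow> bool"
  where "operator_system B E V W t \<longleftrightarrow>
    (\<forall>k. \<forall>\<beta>\<in>carrier B. multilinear_on V k (t k \<beta>) \<and>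
       (\<forall>xs\<in>lists V. length xs = k \<longrightarrow> t k \<beta> xs \<in> W)) \<and>
    t 0 \<one>\<^bsub>B\<^esub> [] = 0 \<and>
    (\<forall>\<beta>\<in>carrier B. E \<beta> < 0 \<or> (E \<beta> = 0 \<and> \<beta> \<noteq> \<one>\<^bsub>B\<^esub>) \<longrightarrow> (\<forall>k. vanishes V t k \<beta>)) \<and>
    (\<forall>E0. finite {\<beta> \<in> carrier B. E \<beta> \<le> E0 \<and> (\<exists>k. \<not> vanishes V t k \<beta>)})"

text \<open>\<open>x\<^sup># = (-1)\<^bsup>deg x - 1\<^esup> x\<close>; homogeneous arguments are passed with the list of their degrees.\<close>

definition sharp :: "int \<Rightarrow> 'c::ab_group_add \<Rightarrow> 'c"
  where "sharp p x = (if odd p then x else - x)"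

text \<open>Sums over decompositions of a class range over infinite sets, but by gappedness only finitely
  many terms are nonzero; \<^const>\<open>supp_sum\<close> is the sum of the nonzero terms.\<close>

definition A_infinity_algebra ::
  "('b, 'z) monoid_scheme \<Rightarrow> ('b \<Rightarrow> real) \<Rightarrow> ('b \<Rightarrow> int) \<Rightarrow> (int \<Rightarrow> 'c::real_vector set) \<Rightarrow>
   ('b, 'c, 'c) operators \<Rightarrow> bool"
  where "A_infinity_algebra B E \<mu> C m \<longleftrightarrow>
    operator_system B E (span (\<Union>p. C p)) (span (\<Union>p. C p)) m \<and>
    (\<forall>\<beta>\<in>carrier B. \<forall>ps xs. list_all2 (\<lambda>p x. x \<in> C p) ps xs \<longrightarrow>
       m (length xs) \<beta> xs \<in> C (sum_list ps + 2 - \<mu> \<beta> - int (length xs))) \<and>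
    (\<forall>\<beta>\<in>carrier B. \<forall>ps xs. list_all2 (\<lambda>p x. x \<in> C p) ps xs \<longrightarrow>
       (\<Sum>(a, \<nu>) | a + \<nu> \<le> length xs.
          supp_sum (\<lambda>(\<beta>', \<beta>'').
              m (length xs - \<nu> + 1) \<beta>'
                (map2 sharp (take a ps) (take a xs) @
                 m \<nu> \<beta>'' (take \<nu> (drop a xs)) # drop (a + \<nu>) xs))
            {(\<beta>', \<beta>''). \<beta>' \<in> carrier B \<and> \<beta>'' \<in> carrier B \<and> \<beta>' \<otimes>\<^bsub>B\<^esub> \<beta>'' = \<beta>}) = 0)"

text \<open>The category \<open>UD\<close>, for the graded complex \<open>(C, d)\<close> with unit \<open>u\<close>; \<open>pair \<beta> b\<close> is
  \<open>\<langle>\<partial>\<beta>, b\<rangle>\<close>.\<close>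

definition in_UD ::
  "('b, 'z) monoid_scheme \<Rightarrow> ('b \<Rightarrow> real) \<Rightarrow> ('b \<Rightarrow> int) \<Rightarrow> ('b \<Rightarrow> 'c \<Rightarrow> real) \<Rightarrow>
   (int \<Rightarrow> 'c::real_vector set) \<Rightarrow> ('c \<Rightarrow> 'c) \<Rightarrow> 'c \<Rightarrow> ('b, 'c, 'c) operators \<Rightarrow> bool"
  where "in_UD B E \<mu> pair C d u m \<longleftrightarrow>
    A_infinity_algebra B E \<mu> C m \<and>
    (\<forall>x\<in>span (\<Union>p. C p). m 1 \<one>\<^bsub>B\<^esub> [x] = d x) \<and>
    m 1 \<one>\<^bsub>B\<^esub> [u] = 0 \<and>
    (\<forall>p. \<forall>x\<in>C p. m 2 \<one>\<^bsub>B\<^esub> [u, x] = x \<and>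
       (if even p then m 2 \<one>\<^bsub>B\<^esub> [x, u] else - m 2 \<one>\<^bsub>B\<^esub> [x, u]) = x) \<and>
    (\<forall>k. \<forall>\<beta>\<in>carrier B. (k, \<beta>) \<notin> {(1, \<one>\<^bsub>B\<^esub>), (2, \<one>\<^bsub>B\<^esub>)} \<longrightarrow>
       (\<forall>xs\<in>lists (span (\<Union>p. C p)). length xs = k \<and> u \<in> set xs \<longrightarrow> m k \<beta> xs = 0)) \<and>
    (\<forall>\<beta>\<in>carrier B. \<forall>ps xs. \<forall>e\<in>C 0. list_all2 (\<lambda>p x. x \<in> C p) ps xs \<and>
       (length xs, \<beta>) \<noteq> (0, \<one>\<^bsub>B\<^esub>) \<longrightarrow>
       (\<Sum>i\<le>length xs. m (length xs + 1) \<beta>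
          (map2 sharp (take i ps) (take i xs) @ e # drop i xs)) = 0) \<and>
    (\<forall>\<beta>\<in>carrier B. \<forall>xs\<in>lists (span (\<Union>p. C p)). \<forall>b\<in>C 1. d b = 0 \<and>
       (length xs, \<beta>) \<noteq> (0, \<one>\<^bsub>B\<^esub>) \<longrightarrow>
       (\<Sum>i\<le>length xs. m (length xs + 1) \<beta> (take i xs @ b # drop i xs))
         = pair \<beta> b *\<^sub>R m (length xs) \<beta> xs) \<and>
    (\<forall>k. \<forall>\<beta>\<in>carrier B. \<not> vanishes (span (\<Union>p. C p)) m k \<beta> \<longrightarrow> 0 \<le> \<mu> \<beta>)"

section \<open>The algebra of a Lagrangian and its minimal model\<close>

text \<open>The virtual fundamental chains of the moduli spaces of stable discs enter axiomatically:
  \<open>VFC J\<close> is the set of choices \<open>\<Xi>\<close> for the tame structure \<open>J\<close>, and \<open>mc \<Xi>\<close> the resulting algebra on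
  \<open>\<Omega>\<^sup>*(L)\<close>.  The sign of the product is the one forced by the unit and \<open>A\<^sub>\<infinity>\<close> relations.\<close>

definition virtual_fundamental_chains ::
  "'a::euclidean_space set \<Rightarrow> 'a form \<Rightarrow> 'a set \<Rightarrow> ('a chain set \<Rightarrow> real) \<Rightarrow> ('a chain set \<Rightarrow> int) \<Rightarrow>
   (('a \<Rightarrow> 'a \<Rightarrow> 'a) \<Rightarrow> 'xi set) \<Rightarrow> ('xi \<Rightarrow> ('a chain set, 'a form, 'a form) operators) \<Rightarrow> bool"
  where "virtual_fundamental_chains X \<omega> L E \<mu> VFC mc \<longleftrightarrow>
    (\<exists>J. tame_acs X \<omega> J \<and> VFC J \<noteq> {}) \<and>
    (\<forall>J \<Xi>. tame_acs X \<omega> J \<and> \<Xi> \<in> VFC J \<longrightarrow>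
       in_UD (H2 X L) E \<mu> (\<lambda>\<beta> b. period (bdry X L \<beta>) b) (forms L) (ext_deriv L) (one_form L)
         (mc \<Xi>) \<and>
       (\<forall>p. \<forall>\<alpha>\<in>forms L p. \<forall>\<beta>\<in>all_forms L.
          mc \<Xi> 2 \<one>\<^bsub>H2 X L\<^esub> [\<alpha>, \<beta>] = (if even p then wedge \<alpha> \<beta> else - wedge \<alpha> \<beta>)) \<and>
       (\<forall>k. k \<notin> {1, 2} \<longrightarrow> vanishes (all_forms L) (mc \<Xi>) k \<one>\<^bsub>H2 X L\<^esub>))"

text \<open>Index set of the sums over \<open>(\<ell>, \<beta>\<^sub>0) \<noteq> (1, 0)\<close>, \<open>\<Sum> k\<^sub>j = k\<close>, \<open>\<beta>\<^sub>0 + \<Sum> \<beta>\<^sub>j = \<beta>\<close>: the numbers \<open>k\<^sub>j\<close> are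
  recorded by cutting the argument list \<open>xs\<close> into blocks, block \<open>j\<close> being paired with \<open>\<beta>\<^sub>j\<close>.\<close>

definition hpt_index ::
  "('b, 'z) monoid_scheme \<Rightarrow> 'b \<Rightarrow> 'h list \<Rightarrow> ('b \<times> ('h list \<times> 'b) list) set"
  where "hpt_index B \<beta> xs = {(\<beta>0, bs). \<beta>0 \<in> carrier B \<and> snd ` set bs \<subseteq> carrier B \<and>
    concat (map fst bs) = xs \<and> \<beta>0 \<otimes>\<^bsub>B\<^esub> foldr (\<otimes>\<^bsub>B\<^esub>) (map snd bs) \<one>\<^bsub>B\<^esub> = \<beta> \<and>
    (length bs, \<beta>0) \<noteq> (1, \<one>\<^bsub>B\<^esub>)}"

definition hpt_term ::
  "('b, 'c, 'c) operators \<Rightarrow> ('b, 'h, 'c) operators \<Rightarrow> 'b \<times> ('h list \<times> 'b) list \<Rightarrow> 'c"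
  where "hpt_term mc ii = (\<lambda>(\<beta>0, bs).
    mc (length bs) \<beta>0 (map (\<lambda>(ys, \<beta>'). ii (length ys) \<beta>' ys) bs))"

definition hpt_inclusion ::
  "('b, 'z) monoid_scheme \<Rightarrow> ('b \<Rightarrow> real) \<Rightarrow> 'c::real_vector set \<Rightarrow> ('b, 'c, 'c) operators \<Rightarrow>
   ('h::real_vector \<Rightarrow> 'c) \<Rightarrow> ('c \<Rightarrow> 'c) \<Rightarrow> ('b, 'h, 'c) operators \<Rightarrow> bool"
  where "hpt_inclusion B E V mc i G ii \<longleftrightarrow>
    operator_system B E UNIV V ii \<and>
    (\<forall>x. ii 1 \<one>\<^bsub>B\<^esub> [x] = i x) \<and>
    (\<forall>\<beta>\<in>carrier B. \<forall>xs. (length xs, \<beta>) \<notin> {(0, \<one>\<^bsub>B\<^esub>), (1, \<one>\<^bsub>B\<^esub>)} \<longrightarrow>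
       ii (length xs) \<beta> xs = supp_sum (\<lambda>q. G (hpt_term mc ii q)) (hpt_index B \<beta> xs))"

definition hpt_product ::
  "('b, 'z) monoid_scheme \<Rightarrow> ('b, 'c, 'c) operators \<Rightarrow> ('c \<Rightarrow> 'h::real_vector) \<Rightarrow>
   ('b, 'h, 'c) operators \<Rightarrow> ('b, 'h, 'h) operators"
  where "hpt_product B mc \<pi> ii = (\<lambda>k \<beta> xs.
    if (k, \<beta>) \<in> {(0, \<one>\<^bsub>B\<^esub>), (1, \<one>\<^bsub>B\<^esub>)} then 0
    else supp_sum (\<lambda>q. \<pi> (hpt_term mc ii q)) (hpt_index B \<beta> xs))"

text \<open>The minimal algebras of \<open>L\<close>, for all choices of \<open>J\<close>, \<open>\<Xi>\<close> and \<open>g\<close>.\<close>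

definition minimal_algebras ::
  "nat \<Rightarrow> 'a::euclidean_space set \<Rightarrow> 'a form \<Rightarrow> 'a set \<Rightarrow> ('a chain set \<Rightarrow> real) \<Rightarrow>
   ('a form \<Rightarrow> 'h::real_vector) \<Rightarrow> (('a \<Rightarrow> 'a \<Rightarrow> 'a) \<Rightarrow> 'xi set) \<Rightarrow>
   ('xi \<Rightarrow> ('a chain set, 'a form, 'a form) operators) \<Rightarrow> ('a chain set, 'h, 'h) operators set"
  where "minimal_algebras n X \<omega> L E cls VFC mc = {m. \<exists>J \<Xi> g i \<pi> G ii.
    tame_acs X \<omega> J \<and> \<Xi> \<in> VFC J \<and> riemannian_metric L g \<and> hodge_data n L cls g i \<pi> G \<and>
    hpt_inclusion (H2 X L) E (all_forms L) (mc \<Xi>) i G ii \<and>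
    m = hpt_product (H2 X L) (mc \<Xi>) \<pi> ii}"

section \<open>Unobstructedness\<close>

text \<open>A series \<open>\<Sum> v\<^sub>i T\<^bsup>\<lambda>\<^sub>i\<^esup>\<close> is represented by its coefficient function \<open>\<lambda>\<^sub>i \<mapsto> v\<^sub>i\<close>.  For complex coefficients this is
  the Novikov field \<open>\<Lambda>\<close>, for coefficients in \<open>H \<otimes> \<complex>\<close> it is \<open>H\<close> completed-tensor \<open>\<Lambda>\<close>; the second set is
  the part of valuation \<open>\<ge> 0\<close>.\<close>

definition novikov :: "(real \<Rightarrow> 'v::zero) set"
  where "novikov = {f. \<forall>c. finite {x. x \<le> c \<and> f x \<noteq> 0}}"

definition novikov0 :: "(real \<Rightarrow> 'v::zero) set"
  where "novikov0 = {f \<in> novikov. \<forall>x<0. f x = 0}"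

text \<open>\<open>H \<otimes> \<complex>\<close> is \<open>H \<times> H\<close>, the pair \<open>(u, v)\<close> standing for \<open>u + \<i> v\<close>.\<close>

definition cscale :: "complex \<Rightarrow> 'h::real_vector \<times> 'h \<Rightarrow> 'h \<times> 'h"
  where "cscale z = (\<lambda>(u, v). (Re z *\<^sub>R u - Im z *\<^sub>R v, Re z *\<^sub>R v + Im z *\<^sub>R u))"

definition complexify :: "('h list \<Rightarrow> 'h) \<Rightarrow> ('h::real_vector \<times> 'h) list \<Rightarrow> 'h \<times> 'h"
  where "complexify f xs = (\<Sum>S\<in>Pow {..<length xs}. cscale (\<i> ^ card S)
    (f (map (\<lambda>j. if j \<in> S then snd (xs ! j) else fst (xs ! j)) [0..<length xs]), 0))"

text \<open>Coefficient of \<open>T\<^sup>\<nu>\<close> in the \<open>\<Lambda>\<close>-multilinear extension \<open>f(b,\<dots>,b)\<close> with \<open>k\<close> arguments.\<close>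

definition diag_coeff ::
  "nat \<Rightarrow> ('h list \<Rightarrow> 'h::real_vector) \<Rightarrow> (real \<Rightarrow> 'h \<times> 'h) \<Rightarrow> real \<Rightarrow> 'h \<times> 'h"
  where "diag_coeff k f b \<nu> =
    supp_sum (\<lambda>ls. complexify f (map b ls)) {ls. length ls = k \<and> sum_list ls = \<nu>}"

text \<open>The sum over \<open>k\<close> converges, for each power of \<open>T\<close>, in the finite-dimensional space
  \<open>H \<otimes> \<complex>\<close>; for \<open>b \<in> H\<^sup>1(L;\<Lambda>\<^sub>0)\<close> this is the convergence of the exponential series of
  \<open>\<langle>\<partial>\<beta>, b\<rangle>\<close>.\<close>

definition bounding_cochain ::
  "'a::euclidean_space set \<Rightarrow> 'a set \<Rightarrow> ('a chain set \<Rightarrow> real) \<Rightarrow> ('a form \<Rightarrow> 'h::euclidean_space) \<Rightarrow>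
   ('a chain set, 'h, 'h) operators \<Rightarrow> (real \<Rightarrow> 'h \<times> 'h) \<Rightarrow> bool"
  where "bounding_cochain X L E cls m b \<longleftrightarrow>
    b \<in> novikov0 \<and>
    (\<forall>x. b x \<in> span (\<Union>p\<in>{p. odd p}. coh L cls p) \<times> span (\<Union>p\<in>{p. odd p}. coh L cls p)) \<and>
    (\<exists>w\<in>novikov0. \<forall>x.
       (\<lambda>k. supp_sum (\<lambda>\<beta>. diag_coeff k (m k \<beta>) b (x - E \<beta>)) (carrier (H2 X L)))
         sums cscale (w x) (cls (one_form L), 0))"

text \<open>\<open>\<Sum>\<^sub>\<beta> T\<^bsup>E(\<beta>)\<^esup> Y\<^bsup>\<partial>\<beta>\<^esup> m\<^bsub>0,\<beta>\<^esub> = W 1 + \<Sum> Q\<^sub>i \<Theta>\<^sub>i\<close>, compared at each \<open>T\<^sup>x Y\<^sup>\<gamma>\<close>.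
  A formal series in \<open>Y\<close> is any function \<open>H\<^sub>1(L) \<rightarrow> \<Lambda>\<close>, since \<open>H\<^sub>1(L)\<close> is countable.\<close>

definition WQ_expansion ::
  "'a::euclidean_space set \<Rightarrow> 'a set \<Rightarrow> ('a chain set \<Rightarrow> real) \<Rightarrow> ('a form \<Rightarrow> 'h::real_vector) \<Rightarrow>
   ('a chain set, 'h, 'h) operators \<Rightarrow> 'h list \<Rightarrow> ('a chain set \<Rightarrow> real \<Rightarrow> complex) \<Rightarrow>
   (nat \<Rightarrow> 'a chain set \<Rightarrow> real \<Rightarrow> complex) \<Rightarrow> bool"
  where "WQ_expansion X L E cls m \<Theta> W Q \<longleftrightarrow>
    (\<forall>\<gamma>\<in>carrier (H1 X L). W \<gamma> \<in> novikov \<and> (\<forall>i<length \<Theta>. Q i \<gamma> \<in> novikov) \<and>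
      (\<forall>x. (supp_sum (\<lambda>\<beta>. m 0 \<beta> []) {\<beta> \<in> carrier (H2 X L). bdry X L \<beta> = \<gamma> \<and> E \<beta> = x}, 0)
         = cscale (W \<gamma> x) (cls (one_form L), 0) +
           (\<Sum>i<length \<Theta>. cscale (Q i \<gamma> x) (\<Theta> ! i, 0))))"

definition Q_vanish ::
  "'a::euclidean_space set \<Rightarrow> 'a set \<Rightarrow> ('a chain set \<Rightarrow> real) \<Rightarrow> ('a form \<Rightarrow> 'h::real_vector) \<Rightarrow>
   ('a chain set, 'h, 'h) operators \<Rightarrow> bool"
  where "Q_vanish X L E cls m \<longleftrightarrow> (\<exists>\<Theta> W Q.
    distinct \<Theta> \<and> independent (set \<Theta>) \<and> span (set \<Theta>) = coh L cls 2 \<and>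
    WQ_expansion X L E cls m \<Theta> W Q \<and>
    (\<forall>i<length \<Theta>. \<forall>\<gamma>\<in>carrier (H1 X L). Q i \<gamma> = 0))"

definition properly_unobstructed ::
  "nat \<Rightarrow> 'a::euclidean_space set \<Rightarrow> 'a form \<Rightarrow> 'a set \<Rightarrow> ('a chain set \<Rightarrow> real) \<Rightarrow>
   ('a form \<Rightarrow> 'h::real_vector) \<Rightarrow> (('a \<Rightarrow> 'a \<Rightarrow> 'a) \<Rightarrow> 'xi set) \<Rightarrow>
   ('xi \<Rightarrow> ('a chain set, 'a form, 'a form) operators) \<Rightarrow> bool"
  where "properly_unobstructed n X \<omega> L E cls VFC mc \<longleftrightarrow>
    (\<exists>m\<in>minimal_algebras n X \<omega> L E cls VFC mc. Q_vanish X L E cls m)"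

definition weakly_unobstructed ::
  "nat \<Rightarrow> 'a::euclidean_space set \<Rightarrow> 'a form \<Rightarrow> 'a set \<Rightarrow> ('a chain set \<Rightarrow> real) \<Rightarrow>
   ('a form \<Rightarrow> 'h::euclidean_space) \<Rightarrow> (('a \<Rightarrow> 'a \<Rightarrow> 'a) \<Rightarrow> 'xi set) \<Rightarrow>
   ('xi \<Rightarrow> ('a chain set, 'a form, 'a form) operators) \<Rightarrow> bool"
  where "weakly_unobstructed n X \<omega> L E cls VFC mc \<longleftrightarrow>
    (\<exists>m\<in>minimal_algebras n X \<omega> L E cls VFC mc. \<exists>b. bounding_cochain X L E cls m b)"

end

theory Submission
  imports Defs
begin

text \<open>
  The zero cochain is a weak bounding cochain.  Every operator with at least one input kills
  \<open>(0, \<dots>, 0)\<close>, so at \<open>b = 0\<close> the Maurer--Cartan series reduces to the curvature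
  \<open>\<Sum>\<^sub>\<beta> T\<^bsup>E(\<beta>)\<^esup> m\<^bsub>0,\<beta>\<^esub>\<close>.  This is the value at \<open>Y = 1\<close> of the series
  \<open>\<Sum>\<^sub>\<beta> T\<^bsup>E(\<beta>)\<^esup> Y\<^bsup>\<partial>\<beta>\<^esup> m\<^bsub>0,\<beta>\<^esub> = W \<cdot> 1 + \<Sum>\<^sub>i Q\<^sub>i \<Theta>\<^sub>i\<close>.  If the \<open>Q\<^sub>i\<close> vanish, it is a multiple \<open>w \<cdot> 1\<close> of the unit,
  where \<open>w = \<Sum>\<^sub>\<gamma> W\<^sub>\<gamma>\<close> is the value of \<open>W\<close> at \<open>Y = 1\<close>.

  What needs proof is that setting \<open>Y = 1\<close> is legitimate: below any energy only finitely many
  classes \<open>\<beta>\<close> may have \<open>m\<^bsub>0,\<beta>\<^esub> \<noteq> 0\<close>, so that \<open>w\<close> is an element of \<open>\<Lambda>\<^sub>0\<close>.  The minimal model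
  is given by sums over trees, and its gappedness has to be derived from that of the algebra
  on forms and of the inclusion.  A nonzero term of the tree sum for \<open>m\<^bsub>0,\<beta>\<^esub>\<close> writes \<open>\<beta>\<close> as
  \<open>\<beta>\<^sub>0 + \<beta>\<^sub>1 + \<dots> + \<beta>\<^sub>l\<close>, where \<open>\<beta>\<^sub>0\<close> supports an operator on forms and each \<open>\<beta>\<^sub>j\<close> with \<open>j \<ge> 1\<close> supports
  a curvature term of the inclusion and hence has strictly positive energy
  (\<open>hpt_curvature_decomposition\<close>).  Since the energies of the \<open>\<beta>\<^sub>j\<close> are bounded away from \<open>0\<close>, an
  energy bound on \<open>\<beta>\<close> bounds \<open>l\<close> and leaves finitely many choices for each summand
  (\<open>finite_hpt_curvature\<close>).
\<close>

section \<open>Multilinear operators on zero arguments\<close>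

lemma multilinear_on_zero_entry:
  assumes "multilinear_on V k f" "xs \<in> lists V" "length xs = k" "0 \<in> set xs"
  shows "f xs = 0"
proof -
  obtain us vs where xs: "xs = us @ 0 # vs"
    using assms(4) by (meson split_list)
  have "us \<in> lists V" "vs \<in> lists V" "0 \<in> V" "length us + length vs + 1 = k"
    using assms xs by auto
  then have "f (us @ (0 *\<^sub>R 0 + 0 *\<^sub>R 0) # vs) = 0 *\<^sub>R f (us @ 0 # vs) + 0 *\<^sub>R f (us @ 0 # vs)"
    using assms(1) unfolding multilinear_on_def by blast
  then show ?thesis by (simp add: xs)
qed

lemma linear_into_zero:
  assumes "linear_into V W f" "0 \<in> V"
  shows "f 0 = 0"
proof -
  have "f (0 *\<^sub>R 0 + 0 *\<^sub>R 0) = 0 *\<^sub>R f 0 + 0 *\<^sub>R f 0"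
    using assms unfolding linear_into_def by blast
  then show ?thesis by simp
qed

lemma supp_sum_neutral: "(\<And>x. x \<in> S \<Longrightarrow> f x = 0) \<Longrightarrow> supp_sum f S = 0"
  unfolding supp_sum_def support_on_def by (rule sum.neutral) auto

lemma supp_sum_singleton: "supp_sum f {a} = f a"
proof -
  have "support_on {a} f = (if f a = 0 then {} else {a})"
    by (auto simp: support_on_def)
  then show ?thesis by (simp add: supp_sum_def)
qed

lemma cscale_simps [simp]: "cscale 0 x = 0" "cscale 1 x = x" "cscale z 0 = 0"
  by (auto simp: cscale_def zero_prod_def split: prod.splits)

lemma cscale_sum_left: "cscale (\<Sum>i\<in>I. z i) x = (\<Sum>i\<in>I. cscale (z i) x)"
proof (induction I rule: infinite_finite_induct)
  case (insert i I)
  have "cscale (a + b) x = cscale a x + cscale b x" for a b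
    by (cases x) (simp add: cscale_def algebra_simps)
  with insert show ?case by simp
qed auto

lemma diag_coeff_zero_cochain:
  "diag_coeff 0 f (\<lambda>_. 0) \<nu> = (if \<nu> = 0 then (f [], 0) else 0)"
  "f (replicate k 0) = 0 \<Longrightarrow> diag_coeff k f (\<lambda>_. 0) \<nu> = 0"
proof -
  have "complexify f [] = (f [], 0)"
    by (simp add: complexify_def)
  moreover have "{ls. length ls = 0 \<and> sum_list ls = \<nu>} = (if \<nu> = 0 then {[]} else {})"
    by auto
  ultimately show "diag_coeff 0 f (\<lambda>_. 0) \<nu> = (if \<nu> = 0 then (f [], 0) else 0)"
    unfolding diag_coeff_def by (simp only: supp_sum_singleton if_distrib[of "supp_sum _"] list.map)
      (simp add: supp_sum_neutral)
next
  assume f: "f (replicate k 0) = 0"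
  have "complexify f (map (\<lambda>_. 0) ls) = 0" if "length ls = k" for ls :: "real list"
  proof -
    have "map (\<lambda>j. if j \<in> S then snd (map (\<lambda>_. 0::'a \<times> 'a) ls ! j)
        else fst (map (\<lambda>_. 0::'a \<times> 'a) ls ! j)) [0..<k] = replicate k 0" for S
      using that by (intro nth_equalityI) auto
    then show ?thesis
      using that f by (simp add: complexify_def flip: zero_prod_def)
  qed
  then show "diag_coeff k f (\<lambda>_. 0) \<nu> = 0"
    unfolding diag_coeff_def by (intro supp_sum_neutral) auto
qed

section \<open>Gappedness of the curvature of the minimal model\<close>

lemma hpt_blocks_in_lists:
  assumes ii: "operator_system B E UNIV V ii" and q: "(\<beta>0, bs) \<in> hpt_index B \<beta> xs"
  shows "map (\<lambda>(ys, \<beta>'). ii (length ys) \<beta>' ys) bs \<in> lists V"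
proof -
  have "ii (length ys) \<beta>' ys \<in> V" if b: "(ys, \<beta>') \<in> set bs" for ys \<beta>'
  proof -
    have "\<beta>' \<in> carrier B"
      using q b by (force simp: hpt_index_def)
    then show ?thesis
      using ii unfolding operator_system_def by simp
  qed
  then show ?thesis by auto
qed

lemma hpt_term_eq_0:
  assumes mc: "operator_system B E V V mc" and ii: "operator_system B E UNIV V ii"
    and q: "(\<beta>0, bs) \<in> hpt_index B \<beta> xs"
    and block: "(ys, \<beta>') \<in> set bs" "ii (length ys) \<beta>' ys = 0"
  shows "hpt_term mc ii (\<beta>0, bs) = 0"
proof -
  let ?zs = "map (\<lambda>(ys, \<beta>'). ii (length ys) \<beta>' ys) bs"
  have "?zs \<in> lists V"
    by (rule hpt_blocks_in_lists[OF ii q])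
  moreover have "0 \<in> set ?zs"
    using block by force
  moreover have "multilinear_on V (length bs) (mc (length bs) \<beta>0)"
    using mc q by (auto simp: operator_system_def hpt_index_def)
  ultimately show ?thesis
    unfolding hpt_term_def by (simp add: multilinear_on_zero_entry[of V "length bs"])
qed

text \<open>A zero input lies in one of the blocks of each decomposition and kills the factor of that
  block.\<close>

lemma hpt_product_zero_entry:
  assumes mc: "operator_system B E V V mc" and ii: "operator_system B E UNIV V ii"
    and \<pi>: "linear_into V UNIV \<pi>" "0 \<in> V"
    and "0 \<in> set xs"
  shows "hpt_product B mc \<pi> ii (length xs) \<beta> xs = 0"
proof -
  have "\<pi> (hpt_term mc ii q) = 0" if q: "q \<in> hpt_index B \<beta> xs" for q
  proof -
    obtain \<beta>0 bs where [simp]: "q = (\<beta>0, bs)"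
      by (cases q)
    have "0 \<in> set (concat (map fst bs))" "snd ` set bs \<subseteq> carrier B"
      using q \<open>0 \<in> set xs\<close> by (auto simp: hpt_index_def)
    then obtain ys \<beta>' where b: "(ys, \<beta>') \<in> set bs" "0 \<in> set ys" "\<beta>' \<in> carrier B"
      by force
    then have "ii (length ys) \<beta>' ys = 0"
      using ii multilinear_on_zero_entry[of UNIV "length ys" "ii (length ys) \<beta>'" ys]
      by (auto simp: operator_system_def)
    then show ?thesis
      using hpt_term_eq_0[OF mc ii] q b(1) linear_into_zero[OF \<pi>] by force
  qed
  then show ?thesis
    by (simp add: hpt_product_def supp_sum_neutral)
qed

lemma additive_foldr:
  fixes E :: "'b \<Rightarrow> real"
  assumes "monoid B"
    and E: "\<forall>\<beta>\<in>carrier B. \<forall>\<beta>'\<in>carrier B. E (\<beta> \<otimes>\<^bsub>B\<^esub> \<beta>') = E \<beta> + E \<beta>'"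
    and "set \<gamma>s \<subseteq> carrier B"
  shows "foldr (\<otimes>\<^bsub>B\<^esub>) \<gamma>s \<one>\<^bsub>B\<^esub> \<in> carrier B \<and> E (foldr (\<otimes>\<^bsub>B\<^esub>) \<gamma>s \<one>\<^bsub>B\<^esub>) = sum_list (map E \<gamma>s)"
proof -
  interpret monoid B by fact
  have "E (\<one>\<^bsub>B\<^esub> \<otimes>\<^bsub>B\<^esub> \<one>\<^bsub>B\<^esub>) = E \<one>\<^bsub>B\<^esub> + E \<one>\<^bsub>B\<^esub>"
    using E by blast
  then have "E \<one>\<^bsub>B\<^esub> = 0" by simp
  with \<open>set \<gamma>s \<subseteq> carrier B\<close> E show ?thesis
    by (induction \<gamma>s) auto
qed

text \<open>Without inputs all blocks are empty, so each \<open>\<beta>\<^sub>j\<close> enters through \<open>\<ii>\<^bsub>0,\<beta>\<^sub>j\<^esub>\<close>.  As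
  \<open>\<ii>\<^bsub>0,0\<^esub> = 0\<close>, gappedness makes its energy strictly positive.\<close>

lemma hpt_curvature_decomposition:
  assumes mc: "operator_system B E V V mc" and ii: "operator_system B E UNIV V ii"
    and \<pi>: "linear_into V UNIV \<pi>" "0 \<in> V"
    and nz: "hpt_product B mc \<pi> ii 0 \<beta> [] \<noteq> 0"
  obtains \<beta>0 \<gamma>s where "\<beta> = \<beta>0 \<otimes>\<^bsub>B\<^esub> foldr (\<otimes>\<^bsub>B\<^esub>) \<gamma>s \<one>\<^bsub>B\<^esub>"
    "\<beta>0 \<in> carrier B" "0 \<le> E \<beta>0" "\<exists>k. \<not> vanishes V mc k \<beta>0"
    "\<And>\<gamma>. \<gamma> \<in> set \<gamma>s \<Longrightarrow> \<gamma> \<in> carrier B \<and> 0 < E \<gamma> \<and> (\<exists>k. \<not> vanishes UNIV ii k \<gamma>)"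
proof -
  obtain \<beta>0 bs where q: "(\<beta>0, bs) \<in> hpt_index B \<beta> []"
    and nzq: "\<pi> (hpt_term mc ii (\<beta>0, bs)) \<noteq> 0"
    using nz supp_sum_neutral[of "hpt_index B \<beta> []" "\<lambda>q. \<pi> (hpt_term mc ii q)"]
    by (auto simp: hpt_product_def split: if_splits)
  let ?zs = "map (\<lambda>(ys, \<beta>'). ii (length ys) \<beta>' ys) bs"
  have nzt: "hpt_term mc ii (\<beta>0, bs) \<noteq> 0"
    using nzq linear_into_zero[OF \<pi>] by auto
  have \<beta>0: "\<beta>0 \<in> carrier B"
    using q by (simp add: hpt_index_def)
  have "?zs \<in> lists V" "length ?zs = length bs"
    using hpt_blocks_in_lists[OF ii q] by auto
  then have nv: "\<not> vanishes V mc (length bs) \<beta>0"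
    using nzt unfolding vanishes_def hpt_term_def prod.case by blast
  then have "0 \<le> E \<beta>0"
    using mc \<beta>0 unfolding operator_system_def by (meson not_le)
  moreover have "\<gamma> \<in> carrier B \<and> 0 < E \<gamma> \<and> (\<exists>k. \<not> vanishes UNIV ii k \<gamma>)"
    if \<gamma>bs: "\<gamma> \<in> set (map snd bs)" for \<gamma>
  proof -
    obtain ys where b: "(ys, \<gamma>) \<in> set bs"
      using \<gamma>bs by auto
    have "ys = []" and \<gamma>: "\<gamma> \<in> carrier B"
      using q b by (auto simp: hpt_index_def)
    then have ne: "ii 0 \<gamma> [] \<noteq> 0"
      using hpt_term_eq_0[OF mc ii q b] nzt by auto
    then have nvi: "\<not> vanishes UNIV ii 0 \<gamma>"
      by (auto simp: vanishes_def)
    moreover have "\<gamma> \<noteq> \<one>\<^bsub>B\<^esub>"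
      using ne ii by (auto simp: operator_system_def)
    ultimately have "\<not> (E \<gamma> < 0 \<or> E \<gamma> = 0)"
      using ii \<gamma> unfolding operator_system_def by blast
    then show ?thesis
      using \<gamma> nvi by auto
  qed
  moreover have "\<beta> = \<beta>0 \<otimes>\<^bsub>B\<^esub> foldr (\<otimes>\<^bsub>B\<^esub>) (map snd bs) \<one>\<^bsub>B\<^esub>"
    using q by (simp add: hpt_index_def)
  ultimately show ?thesis
    using that \<beta>0 nv by blast
qed

lemma hpt_curvature_energy_nonneg:
  assumes B: "monoid B"
    and E: "\<forall>\<beta>\<in>carrier B. \<forall>\<beta>'\<in>carrier B. E (\<beta> \<otimes>\<^bsub>B\<^esub> \<beta>') = E \<beta> + E \<beta>'"
    and mc: "operator_system B E V V mc" and ii: "operator_system B E UNIV V ii"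
    and \<pi>: "linear_into V UNIV \<pi>" "0 \<in> V"
    and nz: "hpt_product B mc \<pi> ii 0 \<beta> [] \<noteq> 0"
  shows "0 \<le> E \<beta>"
proof -
  obtain \<beta>0 \<gamma>s where d: "\<beta> = \<beta>0 \<otimes>\<^bsub>B\<^esub> foldr (\<otimes>\<^bsub>B\<^esub>) \<gamma>s \<one>\<^bsub>B\<^esub>" "\<beta>0 \<in> carrier B" "0 \<le> E \<beta>0"
    "\<And>\<gamma>. \<gamma> \<in> set \<gamma>s \<Longrightarrow> \<gamma> \<in> carrier B \<and> 0 < E \<gamma>"
    using hpt_curvature_decomposition[OF mc ii \<pi> nz] by metis
  have "0 \<le> sum_list (map E \<gamma>s)"
    using d(4) by (intro sum_list_nonneg) force
  moreover have "set \<gamma>s \<subseteq> carrier B"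
    using d(4) by blast
  ultimately show ?thesis
    using additive_foldr[OF B E, of \<gamma>s] E d by auto
qed

text \<open>The class \<open>\<beta>\<close> is recovered from its decomposition, so it suffices to bound the number of
  decompositions.  Gappedness makes the set \<open>I\<close> of possible summands \<open>\<beta>\<^sub>j\<close> finite, hence their
  energies are at least some \<open>\<epsilon> > 0\<close> and there are at most \<open>c / \<epsilon>\<close> of them.\<close>

lemma finite_hpt_curvature:
  assumes B: "monoid B"
    and E: "\<forall>\<beta>\<in>carrier B. \<forall>\<beta>'\<in>carrier B. E (\<beta> \<otimes>\<^bsub>B\<^esub> \<beta>') = E \<beta> + E \<beta>'"
    and mc: "operator_system B E V V mc" and ii: "operator_system B E UNIV V ii"
    and \<pi>: "linear_into V UNIV \<pi>" "0 \<in> V"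
  shows "finite {\<beta>. E \<beta> \<le> c \<and> hpt_product B mc \<pi> ii 0 \<beta> [] \<noteq> 0}"
proof -
  define F where "F = {\<beta> \<in> carrier B. E \<beta> \<le> c \<and> (\<exists>k. \<not> vanishes V mc k \<beta>)}"
  define I where "I = {\<gamma> \<in> carrier B. 0 < E \<gamma> \<and> E \<gamma> \<le> c \<and> (\<exists>k. \<not> vanishes UNIV ii k \<gamma>)}"
  have "finite F"
    using mc unfolding F_def operator_system_def by blast
  have "finite {\<gamma> \<in> carrier B. E \<gamma> \<le> c \<and> (\<exists>k. \<not> vanishes UNIV ii k \<gamma>)}"
    using ii unfolding operator_system_def by blast
  then have "finite I"
    unfolding I_def by (rule rev_finite_subset) auto
  \<comment> \<open>The least positive energy of a summand; the 1 covers the case of empty \<open>I\<close>.\<close>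
  define \<epsilon> where "\<epsilon> = Min (insert 1 (E ` I))"
  have "0 < \<epsilon>"
    using \<open>finite I\<close> by (auto simp: \<epsilon>_def I_def)
  have gap: "\<epsilon> \<le> E \<gamma>" if "\<gamma> \<in> I" for \<gamma>
    using \<open>finite I\<close> that by (auto simp: \<epsilon>_def)
  define N where "N = nat \<lceil>c / \<epsilon>\<rceil>"
  have "\<beta> \<in> (\<lambda>(\<beta>0, \<gamma>s). \<beta>0 \<otimes>\<^bsub>B\<^esub> foldr (\<otimes>\<^bsub>B\<^esub>) \<gamma>s \<one>\<^bsub>B\<^esub>) ` (F \<times> {\<gamma>s. set \<gamma>s \<subseteq> I \<and> length \<gamma>s \<le> N})"
    if \<beta>: "E \<beta> \<le> c" "hpt_product B mc \<pi> ii 0 \<beta> [] \<noteq> 0" for \<beta>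
  proof -
    obtain \<beta>0 \<gamma>s where d: "\<beta> = \<beta>0 \<otimes>\<^bsub>B\<^esub> foldr (\<otimes>\<^bsub>B\<^esub>) \<gamma>s \<one>\<^bsub>B\<^esub>"
      "\<beta>0 \<in> carrier B" "0 \<le> E \<beta>0" "\<exists>k. \<not> vanishes V mc k \<beta>0"
      and g: "\<And>\<gamma>. \<gamma> \<in> set \<gamma>s \<Longrightarrow> \<gamma> \<in> carrier B \<and> 0 < E \<gamma> \<and> (\<exists>k. \<not> vanishes UNIV ii k \<gamma>)"
      using hpt_curvature_decomposition[OF mc ii \<pi> \<beta>(2)] by metis
    have "set \<gamma>s \<subseteq> carrier B"
      using g by blast
    then have total: "E \<beta>0 + sum_list (map E \<gamma>s) \<le> c"
      using additive_foldr[OF B E, of \<gamma>s] E d \<beta>(1) by auto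
    have nonneg: "0 \<le> sum_list (map E \<gamma>s)"
      using g by (intro sum_list_nonneg) force
    have "E \<gamma> \<le> sum_list (map E \<gamma>s)" if "\<gamma> \<in> set \<gamma>s" for \<gamma>
      using that g by (intro member_le_sum_list) force+
    then have "set \<gamma>s \<subseteq> I"
      using g total d(3) unfolding I_def by force
    then have "(\<Sum>\<gamma>\<leftarrow>\<gamma>s. \<epsilon>) \<le> sum_list (map E \<gamma>s)"
      by (intro sum_list_mono gap) auto
    then have "length \<gamma>s * \<epsilon> \<le> c"
      using total d(3) by (simp add: sum_list_triv)
    then have "length \<gamma>s \<le> c / \<epsilon>"
      using \<open>0 < \<epsilon>\<close> by (simp add: pos_le_divide_eq)
    then have "length \<gamma>s \<le> N"
      unfolding N_def by linarith
    moreover have "\<beta>0 \<in> F"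
      using d total nonneg by (auto simp: F_def)
    ultimately show ?thesis
      using d(1) \<open>set \<gamma>s \<subseteq> I\<close> by auto
  qed
  then have "{\<beta>. E \<beta> \<le> c \<and> hpt_product B mc \<pi> ii 0 \<beta> [] \<noteq> 0}
      \<subseteq> (\<lambda>(\<beta>0, \<gamma>s). \<beta>0 \<otimes>\<^bsub>B\<^esub> foldr (\<otimes>\<^bsub>B\<^esub>) \<gamma>s \<one>\<^bsub>B\<^esub>) ` (F \<times> {\<gamma>s. set \<gamma>s \<subseteq> I \<and> length \<gamma>s \<le> N})"
    by blast
  then show ?thesis
    using \<open>finite F\<close> finite_lists_length_le[OF \<open>finite I\<close>]
    by (rule finite_surj[OF finite_cartesian_product, rotated 2])
qed

section \<open>The zero cochain is bounding\<close>

text \<open>At \<open>b = 0\<close> only \<open>k = 0\<close> contributes.  The classes \<open>\<beta>\<close> of energy \<open>x\<close> are sorted by their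
  boundary \<open>\<gamma>\<close>; by \<open>Q = 0\<close> those with boundary \<open>\<gamma>\<close> contribute \<open>W\<^sub>\<gamma> \<cdot> 1\<close>.\<close>

lemma zero_bounding_cochain:
  fixes cls :: "'a::euclidean_space form \<Rightarrow> 'h::euclidean_space"
  assumes zero: "\<And>k \<beta>. 0 < k \<Longrightarrow> m k \<beta> (replicate k 0) = 0"
    and fin: "\<And>c. finite {\<beta> \<in> carrier (H2 X L). E \<beta> \<le> c \<and> m 0 \<beta> [] \<noteq> 0}"
    and pos: "\<And>\<beta>. \<beta> \<in> carrier (H2 X L) \<Longrightarrow> m 0 \<beta> [] \<noteq> 0 \<Longrightarrow> 0 \<le> E \<beta>"
    and Q: "Q_vanish X L E cls m"
  shows "bounding_cochain X L E cls m (\<lambda>_. 0)"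
proof -
  let ?B = "carrier (H2 X L)"
  obtain W where W: "\<And>\<gamma> x. \<gamma> \<in> carrier (H1 X L) \<Longrightarrow>
      (supp_sum (\<lambda>\<beta>. m 0 \<beta> []) {\<beta> \<in> ?B. bdry X L \<beta> = \<gamma> \<and> E \<beta> = x}, 0)
        = cscale (W \<gamma> x) (cls (one_form L), 0)"
    using Q unfolding Q_vanish_def WQ_expansion_def by force
  define S where "S x = {\<beta> \<in> ?B. E \<beta> = x \<and> m 0 \<beta> [] \<noteq> 0}" for x
  have finS: "finite (S x)" for x
    using fin[of x] by (rule rev_finite_subset) (auto simp: S_def)
  \<comment> \<open>The value of \<open>W\<close> at \<open>Y = 1\<close>, summed over the finitely many relevant \<open>\<gamma>\<close> for each power of \<open>T\<close>.\<close>
  define w where "w x = (\<Sum>\<gamma>\<in>bdry X L ` S x. W \<gamma> x)" for x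
  have w_supp: "S x \<noteq> {}" if "w x \<noteq> 0" for x
    using that by (auto simp: w_def)
  have "finite {x. x \<le> c \<and> w x \<noteq> 0}" for c
  proof (rule finite_surj[OF fin[of c]])
    show "{x. x \<le> c \<and> w x \<noteq> 0} \<subseteq> E ` {\<beta> \<in> ?B. E \<beta> \<le> c \<and> m 0 \<beta> [] \<noteq> 0}"
      using w_supp by (fastforce simp: S_def)
  qed
  moreover have "w x = 0" if "x < 0" for x
    using w_supp[of x] pos that by (force simp: S_def)
  ultimately have w: "w \<in> novikov0"
    by (simp add: novikov0_def novikov_def)
  have curv: "(\<Sum>\<beta>\<in>S x. (m 0 \<beta> [], 0)) = cscale (w x) (cls (one_form L), 0)" for x
  proof -
    have "(\<Sum>\<beta>\<in>S x. (m 0 \<beta> [], 0))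
        = (\<Sum>\<gamma>\<in>bdry X L ` S x. \<Sum>\<beta> | \<beta> \<in> S x \<and> bdry X L \<beta> = \<gamma>. (m 0 \<beta> [], 0::'h))"
      by (rule sum.image_gen[OF finS])
    also have "\<dots> = (\<Sum>\<gamma>\<in>bdry X L ` S x. cscale (W \<gamma> x) (cls (one_form L), 0))"
    proof (rule sum.cong[OF refl])
      fix \<gamma> assume "\<gamma> \<in> bdry X L ` S x"
      then have "\<gamma> \<in> carrier (H1 X L)"
        using hom_boundary_carrier[of 2 "top_of_set X" L] by auto
      have "{\<beta> \<in> S x. bdry X L \<beta> = \<gamma>}
          = support_on {\<beta> \<in> ?B. bdry X L \<beta> = \<gamma> \<and> E \<beta> = x} (\<lambda>\<beta>. m 0 \<beta> [])"
        by (auto simp: S_def support_on_def)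
      then have "(\<Sum>\<beta> | \<beta> \<in> S x \<and> bdry X L \<beta> = \<gamma>. (m 0 \<beta> [], 0::'h))
          = (supp_sum (\<lambda>\<beta>. m 0 \<beta> []) {\<beta> \<in> ?B. bdry X L \<beta> = \<gamma> \<and> E \<beta> = x}, 0)"
        by (simp add: supp_sum_def sum_prod)
      then show "(\<Sum>\<beta> | \<beta> \<in> S x \<and> bdry X L \<beta> = \<gamma>. (m 0 \<beta> [], 0::'h))
          = cscale (W \<gamma> x) (cls (one_form L), 0)"
        using W[OF \<open>\<gamma> \<in> carrier (H1 X L)\<close>] by simp
    qed
    finally show ?thesis
      by (simp add: w_def cscale_sum_left)
  qed
  have "(\<lambda>k. supp_sum (\<lambda>\<beta>. diag_coeff k (m k \<beta>) (\<lambda>_. 0) (x - E \<beta>)) ?B)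
      sums cscale (w x) (cls (one_form L), 0)" for x
  proof -
    have "supp_sum (\<lambda>\<beta>. diag_coeff k (m k \<beta>) (\<lambda>_. 0) (x - E \<beta>)) ?B = 0" if "k \<noteq> 0" for k
      using that zero by (simp add: diag_coeff_zero_cochain(2) supp_sum_neutral)
    moreover have "supp_sum (\<lambda>\<beta>. diag_coeff 0 (m 0 \<beta>) (\<lambda>_. 0) (x - E \<beta>)) ?B
        = (\<Sum>\<beta>\<in>S x. (m 0 \<beta> [], 0))"
    proof -
      have "(v, 0::'h) = 0 \<longleftrightarrow> v = 0" for v :: 'h
        by (simp add: zero_prod_def)
      then show ?thesis
        unfolding supp_sum_def
        by (intro sum.cong) (auto simp: support_on_def S_def diag_coeff_zero_cochain(1) split: if_splits)
    qed
    ultimately show ?thesis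
      using sums_finite[of "{0}" "\<lambda>k. supp_sum (\<lambda>\<beta>. diag_coeff k (m k \<beta>) (\<lambda>_. 0) (x - E \<beta>)) ?B"]
      by (simp add: curv)
  qed
  moreover have "(0 :: 'h \<times> 'h) \<in> span A \<times> span A" for A :: "'h set"
    by (simp add: zero_prod_def span_zero)
  ultimately show ?thesis
    using w unfolding bounding_cochain_def by (auto simp: novikov0_def novikov_def)
qed

theorem proposition1p6:
  fixes X L :: "'a::euclidean_space set"
    and \<omega> :: "'a form"
    and n :: nat
    and E :: "'a chain set \<Rightarrow> real"
    and \<mu> :: "'a chain set \<Rightarrow> int"
    and cls :: "'a form \<Rightarrow> 'h::euclidean_space"
    and VFC :: "('a \<Rightarrow> 'a \<Rightarrow> 'a) \<Rightarrow> 'xi set"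
    and mc :: "'xi \<Rightarrow> ('a chain set, 'a form, 'a form) operators"
  assumes "symplectic_manifold n X \<omega>"
    and "compact X \<or> convex_at_infinity X \<omega>"
    and "lagrangian n X \<omega> L" "compact L" "spin n L"
    and "is_energy X \<omega> L E"
    and "is_maslov n X \<omega> L \<mu>"
    and "(\<forall>\<beta>\<in>carrier (H2 X L). \<mu> \<beta> = 0) \<or> graded_lagrangian n X \<omega> L"
    and "is_de_Rham L cls"
    and "virtual_fundamental_chains X \<omega> L E \<mu> VFC mc"
    and "properly_unobstructed n X \<omega> L E cls VFC mc"
  shows "weakly_unobstructed n X \<omega> L E cls VFC mc \<and>
    (\<forall>m\<in>minimal_algebras n X \<omega> L E cls VFC mc.
       Q_vanish X L E cls m \<longrightarrow> (\<exists>b. bounding_cochain X L E cls m b))"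
proof -
  have bc: "bounding_cochain X L E cls m (\<lambda>_. 0)"
    if m: "m \<in> minimal_algebras n X \<omega> L E cls VFC mc" and Q: "Q_vanish X L E cls m" for m
  proof -
    obtain J \<Xi> g i \<pi> G ii where d: "tame_acs X \<omega> J" "\<Xi> \<in> VFC J" "hodge_data n L cls g i \<pi> G"
        "hpt_inclusion (H2 X L) E (all_forms L) (mc \<Xi>) i G ii"
      and m_eq: "m = hpt_product (H2 X L) (mc \<Xi>) \<pi> ii"
      using m unfolding minimal_algebras_def by blast
    have op: "operator_system (H2 X L) E (all_forms L) (all_forms L) (mc \<Xi>)"
      using assms(10) d(1,2)
      unfolding virtual_fundamental_chains_def in_UD_def A_infinity_algebra_def all_forms_def
      by blast
    have ii: "operator_system (H2 X L) E UNIV (all_forms L) ii"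
      using d(4) unfolding hpt_inclusion_def by blast
    have \<pi>: "linear_into (all_forms L) UNIV \<pi>"
      using d(3) unfolding hodge_data_def by blast
    have z: "0 \<in> all_forms L"
      by (simp add: all_forms_def span_zero)
    have B: "monoid (H2 X L)"
      using group.is_monoid group_relative_homology_group by blast
    have E: "\<forall>\<beta>\<in>carrier (H2 X L). \<forall>\<beta>'\<in>carrier (H2 X L). E (\<beta> \<otimes>\<^bsub>H2 X L\<^esub> \<beta>') = E \<beta> + E \<beta>'"
      using assms(6) unfolding is_energy_def by blast
    show ?thesis
    proof (rule zero_bounding_cochain[OF _ _ _ Q])
      show "m k \<beta> (replicate k 0) = 0" if "0 < k" for k \<beta>
        using hpt_product_zero_entry[OF op ii \<pi> z, of "replicate k 0"] that
        by (simp add: m_eq)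
      show "finite {\<beta> \<in> carrier (H2 X L). E \<beta> \<le> c \<and> m 0 \<beta> [] \<noteq> 0}" for c
        using finite_hpt_curvature[OF B E op ii \<pi> z, of c]
        by (rule rev_finite_subset) (auto simp: m_eq)
      show "0 \<le> E \<beta>" if "m 0 \<beta> [] \<noteq> 0" for \<beta>
        using hpt_curvature_energy_nonneg[OF B E op ii \<pi> z] that by (simp add: m_eq)
    qed
  qed
  then show ?thesis
    using assms(11) unfolding properly_unobstructed_def weakly_unobstructed_def by blast
qed

end
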